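(* Let $m\ge 1$ be an integer. The coefficient of $x^n$ in $\Gamma_m^{\mathcal{IS}}(x)$, the generating function of inversion sequences having $\mathrm{mex}$ $m$ with respect to the size, is $0$ when $n<m$, $1$ when $n=m$, and $$\sum_{k=1}^{m}(-1)^{k+1}(m-k+1)\,S_{m,m-k+1}\,(n-k)!$$ when $n>m$.
   Context: An inversion sequence of size $n$ is an $n$-tuple $(x_1,\ldots,x_n)$ of nonnegative integers with $x_i\le i-1$ for all $i\le n$. Its $\mathrm{mex}$ is the minimum natural number $m$ (with $0$ counted as a natural number) such that $x_i\ne m$ for all $i\le n$. $\Gamma_m^{\mathcal{IS}}(x)=\sum_{n\ge 0}\gamma_{n,m}^{\mathcal{IS}}x^n$, where $\gamma_{n,m}^{\mathcal{IS}}$ is the number of inversion sequences of size $n$ having $\mathrm{mex}$ $m$. $S_{a,b}$ denotes the Stirling number of the second kind, i.e. the number of set partitions of a set with $a$ elements into $b$ blocks. *)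

theory Defs
  imports
    "HOL-Combinatorics.Stirling"
    "HOL-Library.Disjoint_Sets"
    "HOL-Computational_Algebra.Formal_Power_Series"
begin

text \<open>
  An inversion sequence \<open>(x\<^sub>1, \<dots>, x\<^sub>n)\<close> is represented by the list \<open>[x\<^sub>1, \<dots>, x\<^sub>n]\<close>.
  List positions start at 0, so \<open>x\<^sub>i\<close> is \<open>xs ! (i - 1)\<close> and the condition
  \<open>x\<^sub>i \<le> i - 1\<close> reads \<open>xs ! j \<le> j\<close>.
\<close>

definition inversion_seq :: "nat list \<Rightarrow> bool" where
  "inversion_seq xs \<longleftrightarrow> (\<forall>j < length xs. xs ! j \<le> j)"

definition mex :: "nat list \<Rightarrow> nat" where
  "mex xs = (LEAST m. m \<notin> set xs)"

definition gamma_IS :: "nat \<Rightarrow> nat \<Rightarrow> nat" where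
  "gamma_IS n m = card {xs. length xs = n \<and> inversion_seq xs \<and> mex xs = m}"

definition Gamma_IS :: "nat \<Rightarrow> int fps" where
  "Gamma_IS m = Abs_fps (\<lambda>n. int (gamma_IS n m))"

text \<open>
  The library function \<^const>\<open>Stirling\<close> is defined by its recurrence. The following
  shows that it counts set partitions, the argument order being
  (number of elements, number of blocks).
\<close>

lemma card_partitions_eq_Stirling:
  assumes "finite A"
  shows "card {P. partition_on A P \<and> card P = k} = Stirling (card A) k"
  using assms
proof (induction A arbitrary: k rule: finite_induct)
  case empty
  have e: "{P :: 'a set set. partition_on {} P \<and> card P = k} = (if k = 0 then {{}} else {})"
    by (auto simp: partition_on_empty)
  show ?case unfolding e by (cases k) simp_all
next
  case (insert a B)
  have finB: "finite B" and aB: "a \<notin> B" using insert.hyps by auto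
  have fin: "finite P" if "partition_on (insert a B) P" for P
    using finite_elements[OF _ that] finB by simp
  have finQ: "finite Q" if "partition_on B Q" for Q
    using finite_elements[OF finB that] .
  have sub: "q \<subseteq> B" "q \<noteq> {}" if "partition_on B Q" "q \<in> Q" for q Q
    using that by (auto simp: partition_on_def)
  show ?case
  proof (cases k)
    case 0
    have "{P. partition_on (insert a B) P \<and> card P = k} = {}"
    proof (intro equals0I, clarify)
      fix P assume P: "partition_on (insert a B) P" "k = card P"
      then have "P = {}" using fin[OF P(1)] 0 by simp
      then show False using P(1) by (simp add: partition_on_def)
    qed
    then show ?thesis using 0 finB aB by (simp only: card.empty) simp
  next
    case (Suc j)
    define parts where "parts = (\<lambda>i. {P. partition_on B P \<and> card P = i})"
    define ext where "ext = (\<lambda>(Q, q). insert (insert a q) (Q - {q}))"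
    let ?T = "{P. partition_on (insert a B) P \<and> card P = k}"
    let ?U = "insert {a} ` parts j" and ?V = "ext ` (SIGMA Q : parts k. Q)"
    have fp: "finite (parts i)" for i
      unfolding parts_def
      by (rule finite_subset[OF _ finitely_many_partition_on[OF finB]]) auto
    have U: "?U \<subseteq> ?T"
    proof clarsimp
      fix Q assume "Q \<in> parts j"
      then have Q: "partition_on B Q" "card Q = j" by (auto simp: parts_def)
      have n: "{a} \<notin> Q" using sub[OF Q(1)] aB by blast
      have "partition_on (insert a B) (insert {a} Q)"
        using Q(1) aB by (auto simp: partition_on_def pairwise_insert disjnt_def)
      then show "partition_on (insert a B) (insert {a} Q) \<and> card (insert {a} Q) = k"
        using n finQ[OF Q(1)] Q(2) Suc by simp
    qed
    have V: "?V \<subseteq> ?T"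
    proof clarsimp
      fix Q q assume "Q \<in> parts k" and q: "q \<in> Q"
      then have Q: "partition_on B Q" "card Q = k" by (auto simp: parts_def)
      have n: "insert a q \<notin> Q" using sub[OF Q(1)] aB by blast
      have dj: "disjnt q r" if "r \<in> Q" "r \<noteq> q" for r
        using Q(1) q that by (auto simp: partition_on_def pairwise_def)
      have U: "\<Union> (insert (insert a q) (Q - {q})) = insert a B"
        using Q(1) q by (auto simp: partition_on_def)
      have D: "disjoint (insert (insert a q) (Q - {q}))"
      proof -
        have "disjoint (Q - {q})"
          using Q(1) by (auto simp: partition_on_def pairwise_def)
        moreover have "disjnt (insert a q) r" "disjnt r (insert a q)" if "r \<in> Q - {q}" for r
          using dj[of r] that sub(1)[OF Q(1), of r] aB by (auto simp: disjnt_def)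
        ultimately show ?thesis by (simp add: pairwise_insert)
      qed
      have "card (insert (insert a q) (Q - {q})) = k"
        using n finQ[OF Q(1)] Q(2) q Suc by (simp add: card_Diff_singleton)
      then show "partition_on (insert a B) (ext (Q, q)) \<and> card (ext (Q, q)) = k"
        using U D Q(1) by (auto simp: ext_def partition_on_def)
    qed
    have T: "?T \<subseteq> ?U \<union> ?V"
    proof
      fix P assume "P \<in> ?T"
      then have P: "partition_on (insert a B) P" "card P = k" by auto
      obtain p where p: "p \<in> P" "a \<in> p" using P(1) by (auto simp: partition_on_def)
      have dj: "p \<inter> r = {}" if "r \<in> P" "r \<noteq> p" for r
        using P(1) p that by (auto simp: partition_on_def disjoint_def)
      have UB: "\<Union> (P - {p}) = insert a B - p"
        using P(1) p dj by (fastforce simp: partition_on_def)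
      have D: "disjoint (P - {p})" "{} \<notin> P - {p}"
        using P(1) by (auto simp: partition_on_def pairwise_def)
      show "P \<in> ?U \<union> ?V"
      proof (cases "p = {a}")
        case True
        have "partition_on B (P - {p})"
          using UB D True aB by (auto simp: partition_on_def)
        moreover have "card (P - {p}) = j" using P(2) p Suc by simp
        ultimately have "P - {p} \<in> parts j" by (simp add: parts_def)
        moreover have "P = insert {a} (P - {p})" using True p by blast
        ultimately show ?thesis by blast
      next
        case False
        define q where "q = p - {a}"
        have q: "q \<noteq> {}" "insert a q = p" "q \<subseteq> B"
          using False p P(1) by (auto simp: q_def partition_on_def)
        have "q \<inter> r = {}" if "r \<in> P - {p}" for r using dj[of r] that by (auto simp: q_def)
        then have dq: "disjnt q (\<Union> (P - {p}))" by (auto simp: disjnt_def)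
        have "insert a B - p = B - q" using aB q(2) by auto
        then have "partition_on (B - q) (P - {p})" using UB D by (auto simp: partition_on_def)
        then have pq: "partition_on B (insert q (P - {p}))"
          using partition_on_insert[OF dq, of B] q by simp
        have qn: "q \<notin> P - {p}" using dq q(1) by (auto simp: disjnt_def)
        have "card (insert q (P - {p})) = k"
          using qn fin[OF P(1)] P(2) p Suc by simp
        with pq have "insert q (P - {p}) \<in> parts k" by (simp add: parts_def)
        moreover have "P = ext (insert q (P - {p}), q)"
          using p q(2) qn by (auto simp: ext_def)
        ultimately show ?thesis by blast
      qed
    qed
    have UV: "?U \<inter> ?V = {}"
    proof -
      have "{a} \<notin> ext (Q, q)" if "Q \<in> parts k" "q \<in> Q" for Q q
      proof -
        have "partition_on B Q" using that by (simp add: parts_def)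
        from sub[OF this] that(2) show ?thesis using aB unfolding ext_def by blast
      qed
      then show ?thesis by blast
    qed
    have cU: "card ?U = Stirling (card B) j"
    proof -
      have "{a} \<notin> Q" if "Q \<in> parts j" for Q
        using sub[of Q "{a}"] that aB by (auto simp: parts_def)
      then have "inj_on (insert {a}) (parts j)" by (intro inj_onI) (metis insert_ident)
      then show ?thesis using insert.IH[of j] by (simp add: card_image parts_def)
    qed
    have cV: "card ?V = k * Stirling (card B) k"
    proof -
      have rec: "q = the_elem {r. r \<in> ext (Q, q) \<and> a \<in> r} - {a} \<and>
          Q = insert (the_elem {r. r \<in> ext (Q, q) \<and> a \<in> r} - {a})
            (ext (Q, q) - {the_elem {r. r \<in> ext (Q, q) \<and> a \<in> r}})"
        if "Q \<in> parts k" "q \<in> Q" for Q q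
      proof -
        have Q: "partition_on B Q" using that by (simp add: parts_def)
        have n: "a \<notin> r" if "r \<in> Q" for r using sub[OF Q that] aB by blast
        have "{r. r \<in> ext (Q, q) \<and> a \<in> r} = {insert a q}"
          using n by (auto simp: ext_def)
        then have e: "the_elem {r. r \<in> ext (Q, q) \<and> a \<in> r} = insert a q" by simp
        have "insert a q - {a} = q" using n[OF that(2)] by blast
        moreover have "ext (Q, q) - {insert a q} = Q - {q}"
          using n by (auto simp: ext_def)
        ultimately show ?thesis unfolding e using that(2) by auto
      qed
      have "inj_on ext (SIGMA Q : parts k. Q)"
      proof (rule inj_onI, clarify)
        fix Q q Q' q'
        assume "Q \<in> parts k" "q \<in> Q" "Q' \<in> parts k" "q' \<in> Q'" "ext (Q, q) = ext (Q', q')"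
        then show "Q = Q' \<and> q = q'" using rec[of Q q] rec[of Q' q'] by metis
      qed
      then have "card ?V = card (SIGMA Q : parts k. Q)" by (rule card_image)
      also have "\<dots> = (\<Sum>Q\<in>parts k. card Q)"
        by (rule card_SigmaI) (use fp finQ in \<open>auto simp: parts_def\<close>)
      also have "\<dots> = card (parts k) * k" by (simp add: parts_def)
      finally show ?thesis using insert.IH[of k] by (simp add: parts_def mult.commute)
    qed
    have "?T = ?U \<union> ?V" using U V T by blast
    moreover have "finite ?U" "finite ?V"
      using fp finQ by (auto intro!: finite_imageI finite_SigmaI simp: parts_def)
    ultimately have "card ?T = card ?U + card ?V" using UV by (simp add: card_Un_disjoint)
    then show ?thesis using cU cV Suc finB aB by simp
  qed
qed

end

theory Submission
  imports Defs
begin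

text \<open>
  An inversion sequence has mex \<open>m\<close> iff it avoids \<open>m\<close> and contains all values in \<open>{..<m}\<close>.
  Inclusion-exclusion over the set \<open>{..<m} - U\<close> of small values that are avoided reduces the count
  to inversion sequences avoiding a prescribed set, and those are counted by a product because
  their entries can be chosen independently (\<open>card_inversion_seq_avoiding\<close>).

  If \<open>card U = u\<close>, the entries at positions \<open>i \<ge> m\<close> have \<open>u + (i - m)\<close> choices each, which depends
  on \<open>U\<close> through \<open>u\<close> only. The entries at positions \<open>i < m\<close> have \<open>card (U \<inter> {..i})\<close> choices.
  The product of these, summed over all \<open>U\<close> of size \<open>u\<close>, is \<open>u!\<close> times \<open>Stirling m u\<close>: deciding
  whether the largest value belongs to \<open>U\<close> yields the recurrence for surjections from an
  \<open>m\<close>-element set onto a \<open>u\<close>-element set (\<open>sum_Pow_prod_card_eq_Stirling\<close>).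
  The late positions contribute the rising factorial \<open>u (u + 1) \<dots> (u + j - 1)\<close> with
  \<open>j = n - m\<close>. For \<open>u \<ge> 1\<close> its product with \<open>u!\<close> is \<open>u (u + j - 1)!\<close>, and \<open>u = 0\<close> contributes
  nothing because \<open>Stirling m 0 = 0\<close> for \<open>m \<ge> 1\<close>. The substitution \<open>u = m - k + 1\<close> gives the stated sum.

  For \<open>n = m\<close> the sequence has to be a permutation of \<open>{..<m}\<close>, and the only such inversion
  sequence is the identity; for \<open>n < m\<close> there are too few entries to reach mex \<open>m\<close>.
\<close>

section \<open>Inversion sequences avoiding a set of values\<close>

lemma mex_eq_iff: "mex xs = m \<longleftrightarrow> {..<m} \<subseteq> set xs \<and> m \<notin> set xs"
proof
  have "\<exists>k. k \<notin> set xs" using ex_new_if_finite[OF infinite_UNIV_nat, of "set xs"] by simp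
  then have "mex xs \<notin> set xs" unfolding mex_def by (rule LeastI_ex)
  moreover assume "mex xs = m"
  moreover have "k \<in> set xs" if "k < mex xs" for k
    using not_less_Least[of k "\<lambda>k. k \<notin> set xs"] that by (simp add: mex_def)
  ultimately show "{..<m} \<subseteq> set xs \<and> m \<notin> set xs" by auto
next
  assume "{..<m} \<subseteq> set xs \<and> m \<notin> set xs"
  then show "mex xs = m" unfolding mex_def
    by (intro Least_equality) (auto simp: subset_iff not_less[symmetric])
qed

lemma inversion_seq_snoc:
  "inversion_seq (xs @ [x]) \<longleftrightarrow> inversion_seq xs \<and> x \<le> length xs"
  by (auto simp: inversion_seq_def nth_append less_Suc_eq)

text \<open>
  Forbidding values leaves the entries independent, whereas requiring a value to occur
  ties them together. This is why the count goes through avoided values. Finiteness is carried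
  along in the induction since \<^const>\<open>card\<close> of an infinite set is 0.
\<close>

lemma card_inversion_seq_avoiding:
  "finite {xs. length xs = n \<and> inversion_seq xs \<and> set xs \<inter> V = {}} \<and>
   card {xs. length xs = n \<and> inversion_seq xs \<and> set xs \<inter> V = {}} = (\<Prod>i<n. card ({..i} - V))"
proof (induction n)
  case 0
  have "{xs. length xs = 0 \<and> inversion_seq xs \<and> set xs \<inter> V = {}} = {[]}"
    by (auto simp: inversion_seq_def)
  then show ?case by simp
next
  case (Suc n)
  let ?A = "\<lambda>n. {xs. length xs = n \<and> inversion_seq xs \<and> set xs \<inter> V = {}}"
  have eq: "?A (Suc n) = (\<lambda>(xs, x). xs @ [x]) ` (?A n \<times> ({..n} - V))"
  proof (intro equalityI subsetI)
    fix ys assume "ys \<in> ?A (Suc n)"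
    moreover from this obtain xs x where "ys = xs @ [x]" by (auto simp: length_Suc_conv_rev)
    ultimately show "ys \<in> (\<lambda>(xs, x). xs @ [x]) ` (?A n \<times> ({..n} - V))"
      by (auto simp: inversion_seq_snoc)
  qed (auto simp: inversion_seq_snoc)
  have "inj_on (\<lambda>(xs, x). xs @ [x]) (?A n \<times> ({..n} - V))" by (auto simp: inj_on_def)
  then show ?case unfolding eq
    using Suc.IH by (simp add: card_image card_cartesian_product)
qed

section \<open>The two summation identities\<close>

text \<open>
  The product for a set \<open>U\<close> counts the words \<open>x\<close> of length \<open>m\<close> with \<open>x\<^sub>i \<in> U\<close> and \<open>x\<^sub>i \<le> i\<close>.
  The last position always has all of \<open>U\<close> at its disposal, so for sets of size \<open>u\<close> the sum \<open>f m u\<close>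
  of these products satisfies \<open>f (m + 1) u = u (f m u + f m (u - 1))\<close>, like \<open>u!\<close> times a Stirling
  number. The weight \<open>h\<close> stays arbitrary because splitting \<open>Pow {..<Suc m}\<close> on the membership of \<open>m\<close>
  turns the sum for \<open>h\<close> into the sum for \<open>\<lambda>u. h u * u + h (u + 1) * (u + 1)\<close> one level below.
\<close>

lemma sum_Pow_prod_card_eq_Stirling:
  fixes h :: "nat \<Rightarrow> 'a :: comm_semiring_1"
  shows "(\<Sum>U\<in>Pow {..<m}. h (card U) * (\<Prod>i<m. of_nat (card (U \<inter> {..i})))) =
         (\<Sum>u\<le>m. h u * of_nat (fact u * Stirling m u))"
proof (induction m arbitrary: h)
  case 0
  then show ?case by simp
next
  case (Suc m)
  let ?w = "\<lambda>U. \<Prod>i<m. of_nat (card (U \<inter> {..i})) :: 'a"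
  let ?g = "\<lambda>u. h u * of_nat u + h (Suc u) * of_nat (Suc u)"
  have Pow: "Pow {..<Suc m} = Pow {..<m} \<union> insert m ` Pow {..<m}"
    by (simp add: lessThan_Suc Pow_insert)
  have inj: "inj_on (insert m) (Pow {..<m})"
    by (rule inj_on_inverseI[where g = "\<lambda>U. U - {m}"]) auto
  have no_m: "h (card U) * (\<Prod>i<Suc m. of_nat (card (U \<inter> {..i}))) =
      h (card U) * of_nat (card U) * ?w U" if "U \<in> Pow {..<m}" for U
  proof -
    have "U \<inter> {..m} = U" using that by auto
    then show ?thesis by (simp add: mult_ac)
  qed
  have yes_m: "h (card (insert m U)) * (\<Prod>i<Suc m. of_nat (card (insert m U \<inter> {..i}))) =
      h (Suc (card U)) * of_nat (Suc (card U)) * ?w U" if "U \<in> Pow {..<m}" for U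
  proof -
    have "finite U" "m \<notin> U" using that by (auto intro: finite_subset)
    moreover have "insert m U \<inter> {..m} = insert m U" using that by auto
    moreover have "insert m U \<inter> {..i} = U \<inter> {..i}" if "i < m" for i using that by auto
    ultimately show ?thesis by (simp add: mult_ac)
  qed
  have "(\<Sum>U\<in>Pow {..<Suc m}. h (card U) * (\<Prod>i<Suc m. of_nat (card (U \<inter> {..i})))) =
    (\<Sum>U\<in>Pow {..<m}. h (card U) * (\<Prod>i<Suc m. of_nat (card (U \<inter> {..i})))) +
    (\<Sum>U\<in>Pow {..<m}. h (card (insert m U)) * (\<Prod>i<Suc m. of_nat (card (insert m U \<inter> {..i}))))"
    unfolding Pow by (subst sum.union_disjoint) (auto simp: sum.reindex[OF inj])
  also have "\<dots> = (\<Sum>U\<in>Pow {..<m}. ?g (card U) * ?w U)"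
    by (subst sum.cong[OF refl no_m], assumption, subst sum.cong[OF refl yes_m], assumption)
      (simp only: sum.distrib[symmetric] distrib_right)
  also have "\<dots> = (\<Sum>u\<le>m. ?g u * of_nat (fact u * Stirling m u))"
    by (rule Suc.IH)
  also have "\<dots> = (\<Sum>u\<le>Suc m. h u * of_nat (u * (fact u * Stirling m u))) +
      (\<Sum>u\<le>m. h (Suc u) * of_nat (fact (Suc u) * Stirling m u))"
    by (simp add: sum.distrib algebra_simps)
  also have "(\<Sum>u\<le>Suc m. h u * of_nat (u * (fact u * Stirling m u))) =
      (\<Sum>u\<le>m. h (Suc u) * of_nat (Suc u * (fact (Suc u) * Stirling m (Suc u))))"
    by (subst sum.atMost_Suc_shift) simp
  also have "\<dots> + (\<Sum>u\<le>m. h (Suc u) * of_nat (fact (Suc u) * Stirling m u)) =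
      (\<Sum>u\<le>m. h (Suc u) * of_nat (fact (Suc u) * Stirling (Suc m) (Suc u)))"
    by (simp add: sum.distrib[symmetric] algebra_simps)
  also have "\<dots> = (\<Sum>u\<le>Suc m. h u * of_nat (fact u * Stirling (Suc m) u))"
    by (simp only: sum.atMost_Suc_shift[of _ m]) simp
  finally show ?case .
qed

lemma sum_Pow_alternating:
  assumes "finite A"
  shows "(\<Sum>T\<in>Pow A. (- 1) ^ card T) = (if A = {} then 1 else 0 :: 'a :: comm_ring_1)"
  using assms
proof (induction A rule: finite_induct)
  case (insert a A)
  have inj: "inj_on (insert a) (Pow A)"
    by (rule inj_on_inverseI[where g = "\<lambda>T. T - {a}"]) (use insert.hyps in auto)
  have "card (insert a T) = Suc (card T)" if "T \<in> Pow A" for T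
    using that insert.hyps finite_subset[of T A]
    by (subst card_insert_disjoint) auto
  then show ?case unfolding Pow_insert using insert.hyps
    by (subst sum.union_disjoint) (auto simp: sum.reindex[OF inj] sum_negf)
qed simp

text \<open>
  The alternating sum over the subsets of \<open>B - s x\<close> detects \<open>B \<subseteq> s x\<close>. Those subsets are the
  \<open>T \<subseteq> B\<close> disjoint from \<open>s x\<close>, so exchanging the two sums counts by avoided set.
\<close>

lemma card_superset_by_inclusion_exclusion:
  assumes "finite X" and "finite B"
  shows "of_nat (card {x \<in> X. B \<subseteq> s x}) =
    (\<Sum>T\<in>Pow B. (- 1) ^ card T * of_nat (card {x \<in> X. s x \<inter> T = {}}) :: 'a :: comm_ring_1)"
proof -
  have "of_nat (card {x \<in> X. B \<subseteq> s x}) = (\<Sum>x\<in>X. if B - s x = {} then 1 else 0 :: 'a)"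
    using assms by (simp add: sum.If_cases Int_def)
  also have "\<dots> = (\<Sum>x\<in>X. \<Sum>T\<in>Pow (B - s x). (- 1) ^ card T)"
    using assms by (intro sum.cong refl) (simp add: sum_Pow_alternating)
  also have "\<dots> = (\<Sum>x\<in>X. \<Sum>T\<in>Pow B. if s x \<inter> T = {} then (- 1) ^ card T else 0)"
    using assms by (intro sum.cong refl sum.mono_neutral_cong_left) auto
  also have "\<dots> = (\<Sum>T\<in>Pow B. \<Sum>x\<in>X. if s x \<inter> T = {} then (- 1) ^ card T else 0)"
    by (rule sum.swap)
  also have "\<dots> = (\<Sum>T\<in>Pow B. (- 1) ^ card T * of_nat (card {x \<in> X. s x \<inter> T = {}}))"
    using assms by (simp add: sum.If_cases Int_def mult.commute)
  finally show ?thesis .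
qed

section \<open>Counting by mex\<close>

lemma pochhammer_eq_prod_shifted:
  assumes "m \<le> n"
  shows "(\<Prod>i=m..<n. a + of_nat (i - m)) = pochhammer (a :: 'a :: comm_semiring_1) (n - m)"
  using prod.shift_bounds_nat_ivl[of "\<lambda>i. a + of_nat (i - m)" 0 m "n - m"] assms
  by (simp add: pochhammer_prod)

text \<open>
  Here \<open>U\<close> is the set of values below \<open>m\<close> that remain allowed. Before position \<open>m\<close> only values
  of \<open>U\<close> are available; from position \<open>m\<close> on, all of \<open>U\<close> is, and position
  \<open>i\<close> also admits the values in \<open>{m<..i}\<close>.
\<close>

lemma card_inversion_seq_prescribed:
  assumes "U \<subseteq> {..<m}" and "m \<le> n"
  shows "card {xs. length xs = n \<and> inversion_seq xs \<and> set xs \<inter> insert m ({..<m} - U) = {}} =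
    pochhammer (card U) (n - m) * (\<Prod>i<m. card (U \<inter> {..i}))"
proof -
  let ?V = "insert m ({..<m} - U)"
  have fin: "finite U" using assms(1) by (rule finite_subset) simp
  have small: "card ({..i} - ?V) = card (U \<inter> {..i})" if "i < m" for i
  proof -
    have "{..i} - ?V = U \<inter> {..i}" using that assms(1) by auto
    then show ?thesis by simp
  qed
  have large: "card ({..i} - ?V) = card U + (i - m)" if "m \<le> i" for i
  proof -
    have "{..i} - ?V = U \<union> {m<..i}" using that assms(1) by auto
    moreover have "U \<inter> {m<..i} = {}" using assms(1) by auto
    ultimately show ?thesis using fin by (simp add: card_Un_disjoint)
  qed
  have "{..<n} = {..<m} \<union> {m..<n}" using assms(2) by auto
  then have "(\<Prod>i<n. card ({..i} - ?V)) =
      (\<Prod>i<m. card ({..i} - ?V)) * (\<Prod>i=m..<n. card ({..i} - ?V))"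
    by (simp add: prod.union_disjoint ivl_disj_int)
  also have "\<dots> = (\<Prod>i<m. card (U \<inter> {..i})) * (\<Prod>i=m..<n. card U + (i - m))"
    using small large by simp
  finally show ?thesis
    using card_inversion_seq_avoiding[of n ?V] pochhammer_eq_prod_shifted[OF assms(2), of "card U"]
    by (simp add: mult.commute)
qed

lemma gamma_IS_eq_sum_Stirling:
  assumes "m \<le> n"
  shows "int (gamma_IS n m) =
    (\<Sum>u\<le>m. (- 1) ^ (m - u) * int (pochhammer u (n - m)) * int (fact u * Stirling m u))"
proof -
  let ?X = "{xs. length xs = n \<and> inversion_seq xs \<and> set xs \<inter> {m} = {}}"
  have fin: "finite ?X" using card_inversion_seq_avoiding by blast
  have avoid: "{xs \<in> ?X. set xs \<inter> T = {}} =
      {xs. length xs = n \<and> inversion_seq xs \<and> set xs \<inter> insert m T = {}}" for T by auto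
  have "{xs. length xs = n \<and> inversion_seq xs \<and> mex xs = m} = {xs \<in> ?X. {..<m} \<subseteq> set xs}"
    by (auto simp: mex_eq_iff)
  then have "int (gamma_IS n m) = (\<Sum>T\<in>Pow {..<m}. (- 1) ^ card T *
      int (card {xs. length xs = n \<and> inversion_seq xs \<and> set xs \<inter> insert m T = {}}))"
    unfolding gamma_IS_def
    using card_superset_by_inclusion_exclusion[OF fin finite_lessThan, of m set, where 'a = int]
      avoid by simp
  \<comment> \<open>Passing to the allowed values makes the counts depend on \<open>card (U \<inter> {..i})\<close>.\<close>
  also have "\<dots> = (\<Sum>U\<in>Pow {..<m}. (- 1) ^ card ({..<m} - U) *
      int (card {xs. length xs = n \<and> inversion_seq xs \<and>
        set xs \<inter> insert m ({..<m} - U) = {}}))"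
    by (rule sum.reindex_bij_witness[of _ "\<lambda>U. {..<m} - U" "\<lambda>U. {..<m} - U"])
      (auto simp: double_diff)
  also have "\<dots> = (\<Sum>U\<in>Pow {..<m}. (- 1) ^ (m - card U) * int (pochhammer (card U) (n - m)) *
      (\<Prod>i<m. int (card (U \<inter> {..i}))))"
  proof (rule sum.cong[OF refl])
    fix U assume "U \<in> Pow {..<m}"
    then have U: "U \<subseteq> {..<m}" by simp
    then have "card ({..<m} - U) = m - card U"
      by (simp add: card_Diff_subset finite_subset)
    then show "(- 1) ^ card ({..<m} - U) * int (card {xs. length xs = n \<and> inversion_seq xs \<and>
        set xs \<inter> insert m ({..<m} - U) = {}}) =
      (- 1) ^ (m - card U) * int (pochhammer (card U) (n - m)) * (\<Prod>i<m. int (card (U \<inter> {..i})))"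
      by (simp only: card_inversion_seq_prescribed[OF U assms] of_nat_mult of_nat_prod mult.assoc)
  qed
  also have "\<dots> =
    (\<Sum>u\<le>m. (- 1) ^ (m - u) * int (pochhammer u (n - m)) * int (fact u * Stirling m u))"
    by (rule sum_Pow_prod_card_eq_Stirling)
  finally show ?thesis .
qed

lemma fact_mult_pochhammer: "fact u * pochhammer (Suc u) j = (fact (u + j) :: nat)"
  by (induction j) (simp_all add: pochhammer_Suc algebra_simps)

lemma gamma_IS_eq_zero: "gamma_IS n m = 0" if "n < m"
proof -
  have "mex xs \<noteq> m" if "length xs = n" for xs
  proof
    assume "mex xs = m"
    then have "card {..<m} \<le> card (set xs)" by (intro card_mono) (auto simp: mex_eq_iff)
    then show False using card_length[of xs] that \<open>n < m\<close> by simp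
  qed
  then have "{xs. length xs = n \<and> inversion_seq xs \<and> mex xs = m} = {}" by blast
  then show ?thesis by (simp only: gamma_IS_def card.empty)
qed

text \<open>
  If earlier entries equal their positions, an entry smaller than its own position would repeat
  one of them.
\<close>

lemma distinct_inversion_seq_eq_upt:
  assumes "inversion_seq xs" and "distinct xs"
  shows "xs = [0..<length xs]"
proof (rule nth_equalityI)
  fix j assume "j < length xs"
  then have "xs ! j = j"
  proof (induction j rule: less_induct)
    case (less j)
    show ?case
    proof (rule ccontr)
      assume "xs ! j \<noteq> j"
      then have lt: "xs ! j < j" using assms(1) less.prems by (auto simp: inversion_seq_def le_less)
      then have "xs ! (xs ! j) = xs ! j" using less by simp
      then show False using lt less.prems assms(2) by (simp add: nth_eq_iff_index_eq)
    qed
  qed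
  then show "xs ! j = [0..<length xs] ! j" using \<open>j < length xs\<close> by simp
qed simp

lemma gamma_IS_self: "gamma_IS m m = 1"
proof -
  have "{xs. length xs = m \<and> inversion_seq xs \<and> mex xs = m} = {[0..<m]}"
  proof (intro equalityI subsetI)
    fix xs assume "xs \<in> {xs. length xs = m \<and> inversion_seq xs \<and> mex xs = m}"
    then have xs: "length xs = m" "inversion_seq xs" "{..<m} \<subseteq> set xs"
      by (auto simp: mex_eq_iff)
    then have "m \<le> card (set xs)" using card_mono[of "set xs" "{..<m}"] by simp
    then have "distinct xs" using card_length[of xs] xs(1) by (intro card_distinct) simp
    then show "xs \<in> {[0..<m]}" using distinct_inversion_seq_eq_upt xs by blast
  qed (auto simp: inversion_seq_def mex_eq_iff)
  then show ?thesis by (simp add: gamma_IS_def)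
qed

theorem proposition5p2:
  fixes m n :: nat
  assumes "m \<ge> 1"
  shows "fps_nth (Gamma_IS m) n =
    (if n < m then 0
     else if n = m then 1
     else (\<Sum>k = 1..m. (- 1) ^ (k + 1) * int (m - k + 1) * int (Stirling m (m - k + 1))
             * fact (n - k)))"
proof -
  have "int (gamma_IS n m) = (\<Sum>k = 1..m. (- 1) ^ (k + 1) * int (m - k + 1) *
      int (Stirling m (m - k + 1)) * fact (n - k))" if "m < n"
  proof -
    have zero: "Stirling m 0 = 0" using assms by (cases m) simp_all
    have "int (gamma_IS n m) =
        (\<Sum>u\<le>m. (- 1) ^ (m - u) * int (pochhammer u (n - m)) * int (fact u * Stirling m u))"
      using that by (intro gamma_IS_eq_sum_Stirling) simp
    also have "\<dots> =
        (\<Sum>u = 1..m. (- 1) ^ (m - u) * int (pochhammer u (n - m)) * int (fact u * Stirling m u))"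
      by (rule sum.mono_neutral_right) (auto simp: zero not_less_eq_eq)
    also have "\<dots> = (\<Sum>k = 1..m. (- 1) ^ (k + 1) * int (m - k + 1) *
        int (Stirling m (m - k + 1)) * fact (n - k))"
    proof (rule sum.reindex_bij_witness[of _ "\<lambda>k. m - k + 1" "\<lambda>u. m - u + 1"])
      fix u assume u: "u \<in> {1..m}"
      then obtain v where v: "u = Suc v" by (cases u) auto
      have "n - (m - u + 1) = v + (n - m)" using u v that by simp
      then have "(fact (n - (m - u + 1)) :: int) = int (fact v * pochhammer u (n - m))"
        by (simp only: v fact_mult_pochhammer of_nat_fact)
      moreover have "m - (m - u + 1) + 1 = u" using u by simp
      ultimately show "(- 1) ^ (m - u + 1 + 1) * int (m - (m - u + 1) + 1) *
          int (Stirling m (m - (m - u + 1) + 1)) * fact (n - (m - u + 1)) =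
        (- 1) ^ (m - u) * int (pochhammer u (n - m)) * int (fact u * Stirling m u)"
        by (simp only: v) (simp add: algebra_simps)
    qed auto
    finally show ?thesis .
  qed
  then show ?thesis by (auto simp: Gamma_IS_def gamma_IS_eq_zero gamma_IS_self)
qed

end
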